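(* Let $n$ be a positive integer. Then, as formal power series in $x$ with coefficients in $\mathbb{Z}[u,v]$, $$\sum_{\lambda} x^{|\lambda|}\, u^{|\lceil \lambda \rceil|}\, v^{o(\lceil \lambda \rceil)} \;=\; \frac{(1+uvx)(1+uvx^2)\cdots(1+uvx^n)}{(1-u^2x^{n+1})(1-u^2x^{n+2})\cdots(1-u^2x^{2n})},$$ where the sum is taken over all lecture hall partitions $\lambda=(\lambda_1,\ldots,\lambda_n)$ with $n$ parts.
   Context: A lecture hall partition with $n$ parts is a sequence of non-negative integers $\lambda=(\lambda_1,\lambda_2,\ldots,\lambda_n)$ (zero parts allowed) satisfying $$0\le \frac{\lambda_1}{1}\le\frac{\lambda_2}{2}\le\cdots\le\frac{\lambda_n}{n}.$$ Write $|\lambda|=\sum_{i=1}^n\lambda_i$. Let $\lceil\lambda\rceil=\left(\lceil\lambda_1/1\rceil,\lceil\lambda_2/2\rceil,\ldots,\lceil\lambda_n/n\rceil\right)$, let $|\lceil\lambda\rceil|=\sum_{i=1}^n\lceil\lambda_i/i\rceil$, and let $o(\lceil\lambda\rceil)$ be the number of odd entries of $\lceil\lambda\rceil$, i.e. the number of indices $i\in\{1,\ldots,n\}$ for which $\lceil\lambda_i/i\rceil$ is odd. *)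

theory Defs
  imports
    "HOL-Analysis.Infinite_Sum"
    "HOL-Library.FuncSet"
    "HOL-Computational_Algebra.Polynomial"
    "HOL-Computational_Algebra.Formal_Power_Series"
begin

text \<open>
  The parts are indexed by \<open>{1..n}\<close>; extensionality makes each sequence a unique function, so
  that a sum over this set counts every partition once.  The lower bound \<open>0 \<le> \<lambda> 1 / 1\<close> is
  implicit in the type \<^typ>\<open>nat\<close>.
\<close>

definition lecture_hall_partitions :: "nat \<Rightarrow> (nat \<Rightarrow> nat) set" where
  "lecture_hall_partitions n =
     {l \<in> {1..n} \<rightarrow>\<^sub>E UNIV.
        \<forall>i\<in>{1..<n}. real (l i) / real i \<le> real (l (i + 1)) / real (i + 1)}"

definition weight :: "nat \<Rightarrow> (nat \<Rightarrow> nat) \<Rightarrow> nat" where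
  "weight n l = (\<Sum>i = 1..n. l i)"

definition ceil_part :: "(nat \<Rightarrow> nat) \<Rightarrow> nat \<Rightarrow> nat" where
  "ceil_part l i = nat \<lceil>real (l i) / real i\<rceil>"

definition ceil_weight :: "nat \<Rightarrow> (nat \<Rightarrow> nat) \<Rightarrow> nat" where
  "ceil_weight n l = (\<Sum>i = 1..n. ceil_part l i)"

definition ceil_odd :: "nat \<Rightarrow> (nat \<Rightarrow> nat) \<Rightarrow> nat" where
  "ceil_odd n l = card {i \<in> {1..n}. odd (ceil_part l i)}"

text \<open>
  The ring \<open>\<int>[u,v]\<close> is represented as \<open>\<int>[u][v]\<close>, so power series in \<open>x\<close> over it have type
  \<open>int poly poly fps\<close>; \<open>x\<close> itself is \<^const>\<open>fps_X\<close>.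
\<close>

definition var_u :: "int poly poly fps" where
  "var_u = fps_const [:[:0, 1:]:]"

definition var_v :: "int poly poly fps" where
  "var_v = fps_const [:0, 1:]"

text \<open>
  Division of power series in the library needs an inverse on the coefficient type, which
  \<open>\<int>[u,v]\<close> lacks.  The library's \<open>fps_right_inverse g 1\<close> is the inverse of \<open>g\<close> over any
  commutative ring as soon as \<open>g\<close> has constant coefficient 1.
\<close>

definition fps_frac :: "'a::comm_ring_1 fps \<Rightarrow> 'a fps \<Rightarrow> 'a fps" where
  "fps_frac f g = f * fps_right_inverse g 1"

lemma fps_frac_mult_cancel:
  assumes "fps_nth g 0 = 1"
  shows "fps_frac f g * g = f"
proof -
  have "g * fps_right_inverse g 1 = 1"
    by (rule fps_right_inverse) (simp add: assms)
  then show ?thesis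
    by (metis fps_frac_def mult.assoc mult.commute mult.right_neutral)
qed

end

theory Submission
  imports Defs
begin

text \<open>
  Truncating to ceilings at most \<open>h\<close> makes everything a finite sum.  Write \<open>T h n m\<close> for the sum over
  the truncated partitions with \<open>n\<close> parts in which the exponent of \<open>x\<close> is \<open>|\<lambda>| + m |\<lceil>\<lambda>\<rceil>|\<close>.  Lowering
  the bound on the last part by one at a time shows that the parts of ceiling exactly \<open>h + 1\<close>
  contribute a Gaussian binomial coefficient, which expresses \<open>T (h + 1)\<close> by \<open>T h\<close>.  Reassociating
  Gaussian multinomials, one can instead remove the two lowest ceilings, \<open>0\<close> and \<open>1\<close>, and lower
  the \<open>k\<close> remaining ones by \<open>2\<close>, which preserves parity.  The ceilings \<open>1\<close> sum to a product by the
  \<open>q\<close>-binomial theorem, and so, with \<open>z = u\<^sup>2 x\<^bsup>2m+n+1\<^esup>\<close>,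
  \<open>T (h + 2) n m = (\<Sum>k. [n, k]\<^sub>x z\<^sup>k (\<Prod>i=1..n-k. 1 + u v x\<^bsup>m+i\<^esup>) T h k (m + n - k))\<close>.
  By the identity \<open>(\<Sum>k. [n, k]\<^sub>x z\<^sup>k (\<Prod>j<n-k. 1 - z x\<^sup>j)) = 1\<close> the product formula satisfies the same
  recursion.  As \<open>z\<close> is divisible by \<open>x\<close> and both sides are \<open>1\<close> for \<open>n = 0\<close>, \<open>T (2 h)\<close> agrees with
  the product formula modulo \<open>x\<^sup>h\<close>.
\<close>

section \<open>Gaussian binomial coefficients and their identities\<close>

fun qbinomial :: "'a::comm_ring_1 \<Rightarrow> nat \<Rightarrow> nat \<Rightarrow> 'a" where
  "qbinomial q n 0 = 1"
| "qbinomial q 0 (Suc k) = 0"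
| "qbinomial q (Suc n) (Suc k) = qbinomial q n k + q ^ Suc k * qbinomial q n (Suc k)"

lemma qbinomial_eq_0: "n < k \<Longrightarrow> qbinomial q n k = 0"
  by (induction q n k rule: qbinomial.induct) auto

text \<open>The mirror image of the defining Pascal rule. Expanding by the definition, applying the
  induction hypothesis to both terms and regrouping by the definition avoids any division by
  \<open>1 - q\<close>.\<close>

lemma qbinomial_pascal:
  "k \<le> n \<Longrightarrow> qbinomial q (Suc n) (Suc k) = q ^ (n - k) * qbinomial q n k + qbinomial q n (Suc k)"
proof (induction n arbitrary: k)
  case 0
  then show ?case by simp
next
  case (Suc n)
  have IH: "k \<le> n \<Longrightarrow> q ^ Suc k * qbinomial q (Suc n) (Suc k)
      = q ^ Suc n * qbinomial q n k + q ^ Suc k * qbinomial q n (Suc k)"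
    by (simp only: Suc.IH distrib_left mult.assoc[symmetric] power_add[symmetric]) simp
  show ?case
  proof (cases k)
    case 0
    then show ?thesis using IH by (simp add: algebra_simps)
  next
    case (Suc k')
    have a: "qbinomial q (Suc n) (Suc k') = q ^ (n - k') * qbinomial q n k' + qbinomial q n (Suc k')"
      using Suc Suc.prems Suc.IH by simp
    have c: "q ^ (n - k') * q ^ Suc k' = q ^ Suc n"
      using Suc Suc.prems by (simp flip: power_add del: power_Suc)
    have b: "q ^ Suc k * qbinomial q (Suc n) (Suc k)
      = q ^ Suc n * qbinomial q n k + q ^ Suc k * qbinomial q n (Suc k)"
      using IH Suc Suc.prems by (cases "k \<le> n") (simp_all add: qbinomial_eq_0)
    have "qbinomial q (Suc (Suc n)) (Suc k) = qbinomial q (Suc n) (Suc k') + q ^ Suc k * qbinomial q (Suc n) (Suc k)"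
      using Suc by simp
    also have "\<dots> = q ^ (n - k') * (qbinomial q n k' + q ^ Suc k' * qbinomial q n (Suc k'))
        + (qbinomial q n (Suc k') + q ^ Suc k * qbinomial q n (Suc k))"
      unfolding a b unfolding distrib_left mult.assoc[symmetric] c by (simp only: Suc ac_simps)
    finally show ?thesis using Suc by simp
  qed
qed

definition qfact :: "'a::comm_ring_1 \<Rightarrow> nat \<Rightarrow> 'a" where
  "qfact q n = (\<Prod>i=1..n. 1 - q ^ i)"

lemma qfact_0 [simp]: "qfact q 0 = 1"
  by (simp add: qfact_def)

lemma qfact_Suc: "qfact q (Suc n) = (1 - q ^ Suc n) * qfact q n"
  by (simp add: qfact_def mult.commute)

lemma qbinomial_n_n [simp]: "qbinomial q n n = 1"
  by (induction n) (simp_all add: qbinomial_eq_0)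

text \<open>The quotient formula for Gaussian binomials in division-free form. The induction rests
  on \<open>(1 - q^k) + q^k (1 - q^j) = 1 - q^(k + j)\<close>.\<close>

lemma qbinomial_qfact: "qbinomial q (k + j) k * qfact q k * qfact q j = qfact q (k + j)"
proof (induction "k + j" arbitrary: k j)
  case 0
  then show ?case by simp
next
  case (Suc n)
  show ?case
  proof (cases "k = 0 \<or> j = 0")
    case True
    then show ?thesis by auto
  next
    case False
    then obtain k' j' where kj: "k = Suc k'" "j = Suc j'"
      by (meson not0_implies_Suc)
    have 1: "qbinomial q n k' * qfact q k' * qfact q j = qfact q n"
      using Suc.hyps(1)[of k' j] Suc.hyps(2) kj by simp
    have 2: "qbinomial q n k * qfact q k * qfact q j' = qfact q n"
      using Suc.hyps kj by (metis add_Suc_right nat.inject)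
    have "qbinomial q (k + j) k * qfact q k * qfact q j =
        (qbinomial q n k' + q ^ k * qbinomial q n k) * qfact q k * qfact q j"
      using Suc.hyps(2) kj by (metis qbinomial.simps(3))
    also have "\<dots> = (1 - q ^ k) * (qbinomial q n k' * qfact q k' * qfact q j)
        + q ^ k * (1 - q ^ j) * (qbinomial q n k * qfact q k * qfact q j')"
      unfolding kj qfact_Suc by (simp add: algebra_simps)
    also have "\<dots> = (1 - q ^ (k + j)) * qfact q n"
      unfolding 1 2 by (simp add: algebra_simps power_add)
    finally show ?thesis
      using Suc.hyps(2) by (metis qfact_Suc)
  qed
qed

text \<open>Both sides are the Gaussian multinomial coefficient with lower entries \<open>c\<close>,
  \<open>k\<close>, \<open>p\<close>. Since \<open>q\<close> is not a root of unity, the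
  q-factorials are nonzero and can be cancelled.\<close>

lemma qbinomial_revision:
  fixes q :: "'a::idom"
  assumes "\<And>i. q ^ Suc i \<noteq> 1"
  shows "qbinomial q (c + k + p) c * qbinomial q (k + p) k =
         qbinomial q (c + k + p) (c + k) * qbinomial q (c + k) c"
proof -
  have nz: "qfact q n \<noteq> 0" for n
    using assms by (induction n) (simp_all add: qfact_Suc del: power_Suc)
  have "qbinomial q (c + k + p) c * qbinomial q (k + p) k * (qfact q c * qfact q k * qfact q p) =
      qbinomial q (c + (k + p)) c * qfact q c * (qbinomial q (k + p) k * qfact q k * qfact q p)"
    by (simp add: ac_simps)
  also have "\<dots> = qfact q (c + k + p)"
    unfolding qbinomial_qfact by (simp add: ac_simps)
  also have "\<dots> = qbinomial q (c + k + p) (c + k) * (qbinomial q (c + k) c * qfact q c * qfact q k) * qfact q p"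
    unfolding qbinomial_qfact ..
  also have "\<dots> = qbinomial q (c + k + p) (c + k) * qbinomial q (c + k) c * (qfact q c * qfact q k * qfact q p)"
    by (simp add: ac_simps)
  finally show ?thesis
    using nz by simp
qed

text \<open>The common shape of the inductions below: a Pascal rule splits each term, and the two
  halves are summed separately.\<close>

lemma sum_atMost_Suc_pascal:
  fixes f g :: "nat \<Rightarrow> 'a::comm_ring_1"
  assumes "f 0 = b 0" and "\<And>k. k \<le> n \<Longrightarrow> f (Suc k) = a k + b (Suc k)" and "b (Suc n) = 0"
  shows "(\<Sum>k\<le>Suc n. f k) = (\<Sum>k\<le>n. a k) + (\<Sum>k\<le>n. b k)"
proof -
  have "(\<Sum>k\<le>Suc n. f k) = b 0 + (\<Sum>k\<le>n. a k + b (Suc k))"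
    unfolding sum.atMost_Suc_shift using assms by simp
  also have "\<dots> = (\<Sum>k\<le>n. a k) + (\<Sum>k\<le>Suc n. b k)"
    unfolding sum.atMost_Suc_shift by (simp add: sum.distrib)
  finally show ?thesis using assms by simp
qed

text \<open>\<open>\<Sum>{..b}\<close> is the triangular number b(b+1)/2, which avoids a division.
  The mirrored Pascal rule peels off the factor for \<open>i = Suc n\<close>.\<close>

lemma qbinomial_theorem:
  "(\<Sum>b\<le>n. qbinomial q n b * y ^ b * q ^ (\<Sum>{..b})) = (\<Prod>i=1..n. 1 + y * q ^ i)"
proof (induction n)
  case 0
  then show ?case by simp
next
  case (Suc n)
  have "(\<Sum>b\<le>Suc n. qbinomial q (Suc n) b * y ^ b * q ^ (\<Sum>{..b})) =
     (\<Sum>b\<le>n. y * q ^ Suc n * (qbinomial q n b * y ^ b * q ^ (\<Sum>{..b})))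
     + (\<Sum>b\<le>n. qbinomial q n b * y ^ b * q ^ (\<Sum>{..b}))"
  proof (rule sum_atMost_Suc_pascal)
    fix k assume k: "k \<le> n"
    have "q ^ (n - k) * q ^ (\<Sum>{..Suc k}) = q ^ Suc n * q ^ (\<Sum>{..k})"
      using k by (simp flip: power_add del: power_Suc)
    then show "qbinomial q (Suc n) (Suc k) * y ^ Suc k * q ^ (\<Sum>{..Suc k}) =
       y * q ^ Suc n * (qbinomial q n k * y ^ k * q ^ (\<Sum>{..k}))
       + qbinomial q n (Suc k) * y ^ Suc k * q ^ (\<Sum>{..Suc k})"
      unfolding qbinomial_pascal[OF k] distrib_right power_Suc[of y]
      by (simp add: ac_simps del: sum.atMost_Suc power_Suc)
  qed (simp_all add: qbinomial_eq_0)
  also have "\<dots> = (1 + y * q ^ Suc n) * (\<Prod>i=1..n. 1 + y * q ^ i)"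
    unfolding Suc.IH[symmetric] sum_distrib_left[symmetric] by (simp add: algebra_simps)
  finally show ?case by (simp add: mult.commute)
qed

text \<open>The defining Pascal rule turns the sum into \<open>z\<close> times the shorter sum at
  \<open>z\<close> plus \<open>1 - z\<close> times the shorter sum at \<open>z * q\<close>; hence
  the induction over all \<open>z\<close>.\<close>

lemma qbinomial_partition_unity:
  "(\<Sum>k\<le>n. qbinomial q n k * z ^ k * (\<Prod>j<n - k. 1 - z * q ^ j)) = 1"
proof (induction n arbitrary: z)
  case 0
  then show ?case by simp
next
  case (Suc n)
  have "(\<Sum>k\<le>Suc n. qbinomial q (Suc n) k * z ^ k * (\<Prod>j<Suc n - k. 1 - z * q ^ j)) =
     (\<Sum>k\<le>n. z * (qbinomial q n k * z ^ k * (\<Prod>j<n - k. 1 - z * q ^ j)))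
     + (\<Sum>k\<le>n. (1 - z) * (qbinomial q n k * (z * q) ^ k * (\<Prod>j<n - k. 1 - (z * q) * q ^ j)))"
  proof (rule sum_atMost_Suc_pascal)
    show "qbinomial q (Suc n) 0 * z ^ 0 * (\<Prod>j<Suc n - 0. 1 - z * q ^ j) =
      (1 - z) * (qbinomial q n 0 * (z * q) ^ 0 * (\<Prod>j<n - 0. 1 - (z * q) * q ^ j))"
      by (simp add: prod.lessThan_Suc_shift mult.assoc del: prod.lessThan_Suc)
  next
    fix k assume k: "k \<le> n"
    show "qbinomial q (Suc n) (Suc k) * z ^ Suc k * (\<Prod>j<Suc n - Suc k. 1 - z * q ^ j) =
      z * (qbinomial q n k * z ^ k * (\<Prod>j<n - k. 1 - z * q ^ j)) +
      (1 - z) * (qbinomial q n (Suc k) * (z * q) ^ Suc k * (\<Prod>j<n - Suc k. 1 - (z * q) * q ^ j))"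
    proof (cases "k = n")
      case True
      then show ?thesis by (simp add: qbinomial_eq_0)
    next
      case False
      then have "n - k = Suc (n - Suc k)" using k by simp
      then have "(\<Prod>j<n - k. 1 - z * q ^ j) = (1 - z) * (\<Prod>j<n - Suc k. 1 - (z * q) * q ^ j)"
        by (simp only: prod.lessThan_Suc_shift) (simp add: mult.assoc)
      then show ?thesis
        unfolding diff_Suc_Suc by (simp only: qbinomial.simps(3)) (simp add: algebra_simps power_mult_distrib)
    qed
  qed (simp add: qbinomial_eq_0)
  also have "\<dots> = z + (1 - z)"
    unfolding sum_distrib_left[symmetric] Suc.IH by simp
  finally show ?case by simp
qed


section \<open>Lecture hall partitions with a bounded last part\<close>

lemma lecture_hall_partitions_Suc:
  "l \<in> lecture_hall_partitions (Suc n) \<longleftrightarrow>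
     l(Suc n := undefined) \<in> lecture_hall_partitions n \<and> (n = 0 \<or> l n * Suc n \<le> l (Suc n) * n)"
proof -
  have ext: "l \<in> {1..Suc n} \<rightarrow>\<^sub>E UNIV \<longleftrightarrow> l(Suc n := undefined) \<in> {1..n} \<rightarrow>\<^sub>E UNIV"
    by (auto simp: PiE_UNIV_domain extensional_def PiE_iff)
  have iv: "{1..<Suc n} = (if n = 0 then {} else insert n {1..<n})"
    by auto
  have ratio: "real (l n) / real n \<le> real (l (n + 1)) / real (n + 1) \<longleftrightarrow> l n * Suc n \<le> l (Suc n) * n"
    if "n \<noteq> 0"
  proof -
    have "real (l n) / real n \<le> real (l (n + 1)) / real (n + 1) \<longleftrightarrow>
        real (l n * Suc n) \<le> real (l (Suc n) * n)"
      using that by (simp add: divide_simps algebra_simps)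
    then show ?thesis by (simp only: of_nat_le_iff)
  qed
  show ?thesis
    unfolding lecture_hall_partitions_def mem_Collect_eq ext iv using ratio by auto
qed

lemma lecture_hall_partitions_mono:
  assumes "l \<in> lecture_hall_partitions n" and "i \<in> {1..n}"
  shows "l i \<le> l n"
proof -
  have "i \<le> n" using assms by simp
  then show ?thesis
  proof (induction rule: inc_induct)
    case base
    then show ?case by simp
  next
    case (step k)
    have "real (l k) / real k \<le> real (l (Suc k)) / real (Suc k)"
      using assms step by (auto simp: lecture_hall_partitions_def)
    moreover have "1 \<le> k" using step assms by simp
    ultimately have "real (l k) * real (Suc k) \<le> real (l (Suc k)) * real k"
      by (simp add: divide_simps mult.commute)
    also have "\<dots> \<le> real (l (Suc k)) * real (Suc k)"
      by (intro mult_left_mono) auto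
    finally have "l k \<le> l (Suc k)" by simp
    with step.IH show ?case by simp
  qed
qed

text \<open>As the ratios increase, the bound \<open>j = n * h\<close> says that all ceilings are at
  most \<open>h\<close>. For \<open>n = 0\<close> there is no last part and \<open>l 0\<close> is
  \<open>undefined\<close>, so the bound is waived.\<close>

definition lh_bounded :: "nat \<Rightarrow> nat \<Rightarrow> (nat \<Rightarrow> nat) set" where
  "lh_bounded n j = {l \<in> lecture_hall_partitions n. n = 0 \<or> l n \<le> j}"

lemma finite_lh_bounded: "finite (lh_bounded n j)"
proof (rule finite_subset)
  show "lh_bounded n j \<subseteq> {1..n} \<rightarrow>\<^sub>E {..j}"
  proof
    fix l assume l: "l \<in> lh_bounded n j"
    then have "l i \<le> j" if "i \<in> {1..n}" for i
      using lecture_hall_partitions_mono[of l n i] that by (auto simp: lh_bounded_def)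
    then show "l \<in> {1..n} \<rightarrow>\<^sub>E {..j}"
      using l by (auto simp: lh_bounded_def lecture_hall_partitions_def PiE_iff)
  qed
qed (simp add: finite_PiE)

lemma ceil_part_eq_Suc:
  assumes "l i = i * h + Suc s" and "s < i"
  shows "ceil_part l i = Suc h"
proof -
  have "real (l i) / real i = real h + real (Suc s) / real i"
    using assms by (simp add: field_simps)
  moreover have "0 < real (Suc s) / real i" "real (Suc s) / real i \<le> 1"
    using assms by (auto simp: divide_simps)
  ultimately have "\<lceil>real (l i) / real i\<rceil> = int (Suc h)"
    by (intro ceiling_unique) auto
  then show ?thesis by (simp add: ceil_part_def)
qed

lemma ceil_odd_eq_sum: "ceil_odd n l = (\<Sum>i=1..n. ceil_part l i mod 2)"
  by (simp add: ceil_odd_def mod_2_eq_odd of_bool_def flip: sum.inter_filter)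

lemma two_sum_atMost: "2 * \<Sum>{..c::nat} = c * Suc c"
  by (induction c) auto

lemma sum_atMost_add: "\<Sum>{..c + k::nat} = \<Sum>{..c} + \<Sum>{..k} + c * k"
  by (induction k) auto

lemma sum_triangle:
  "(\<Sum>c\<le>n. \<Sum>k\<le>n - c. f c k) = (\<Sum>K\<le>n. \<Sum>c\<le>K. f c (K - c))"
  for f :: "nat \<Rightarrow> nat \<Rightarrow> 'a::comm_monoid_add"
proof -
  have "(SIGMA c:{..n}. {..n - c}) = {(c, k). c + k \<le> n}"
    by auto
  then show ?thesis
    by (simp add: sum.Sigma sum.triangle_reindex_eq)
qed

section \<open>Truncated sums and removal of the highest ceiling\<close>

locale lecture_hall_weights =
  fixes x u v :: "'a::idom"
  \<comment> \<open>This is what \<open>qbinomial_revision\<close> needs.\<close>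
  assumes power_neq_1: "x ^ Suc i \<noteq> 1"
begin

text \<open>The parameter \<open>m\<close> amounts to replacing \<open>u\<close> by
  \<open>u * x ^ m\<close>.\<close>

definition lh_term :: "nat \<Rightarrow> nat \<Rightarrow> (nat \<Rightarrow> nat) \<Rightarrow> 'a" where
  "lh_term m n l =
     x ^ (weight n l + m * ceil_weight n l) * u ^ ceil_weight n l * v ^ ceil_odd n l"

definition lh_sum :: "nat \<Rightarrow> nat \<Rightarrow> nat \<Rightarrow> 'a" where
  "lh_sum m n j = (\<Sum>l\<in>lh_bounded n j. lh_term m n l)"

definition wt :: "nat \<Rightarrow> 'a" where
  "wt c = u ^ c * v ^ (c mod 2)"

lemma lh_term_upd:
  assumes "ceil_part (l(Suc n := j)) (Suc n) = c"
  shows "lh_term m (Suc n) (l(Suc n := j)) = x ^ (j + m * c) * wt c * lh_term m n l"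
proof -
  have 1: "weight (Suc n) (l(Suc n := j)) = weight n l + j"
    by (simp add: weight_def)
  have eq: "ceil_part (l(Suc n := j)) i = ceil_part l i" if "i \<in> {1..n}" for i
    using that by (simp add: ceil_part_def)
  have 2: "ceil_weight (Suc n) (l(Suc n := j)) = ceil_weight n l + c"
    using assms eq by (simp add: ceil_weight_def)
  have 3: "ceil_odd (Suc n) (l(Suc n := j)) = ceil_odd n l + c mod 2"
    using assms eq by (simp add: ceil_odd_eq_sum)
  show ?thesis
    unfolding lh_term_def wt_def 1 2 3 by (simp add: power_add algebra_simps)
qed

text \<open>Once the last part is fixed, all it imposes on the others is an upper bound on the
  previous part, so a bounded sum remains.\<close>

lemma sum_last_part:
  assumes "\<And>l. l (Suc n) = j \<Longrightarrow> ceil_part l (Suc n) = c"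
  shows "(\<Sum>l | l \<in> lecture_hall_partitions (Suc n) \<and> l (Suc n) = j. lh_term m (Suc n) l)
           = x ^ (j + m * c) * wt c * lh_sum m n (j * n div Suc n)"
proof -
  have und: "l(Suc n := undefined) = l" if "l \<in> lecture_hall_partitions n" for l
    using that by (auto simp: lecture_hall_partitions_def PiE_iff extensional_def fun_eq_iff)
  have le: "a \<le> j * n div Suc n \<longleftrightarrow> a * Suc n \<le> j * n" for a
    by (rule less_eq_div_iff_mult_less_eq) simp
  have "(\<Sum>l | l \<in> lecture_hall_partitions (Suc n) \<and> l (Suc n) = j. lh_term m (Suc n) l)
     = (\<Sum>l\<in>lh_bounded n (j * n div Suc n). lh_term m (Suc n) (l(Suc n := j)))"
    by (rule sum.reindex_bij_witness[where i = "\<lambda>l. l(Suc n := j)" and j = "\<lambda>l. l(Suc n := undefined)"])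
       (auto simp: lecture_hall_partitions_Suc lh_bounded_def le und)
  also have "\<dots> = (\<Sum>l\<in>lh_bounded n (j * n div Suc n). x ^ (j + m * c) * wt c * lh_term m n l)"
    by (intro sum.cong refl lh_term_upd assms) simp
  finally show ?thesis
    by (simp add: lh_sum_def sum_distrib_left)
qed

lemma lh_sum_0 [simp]: "lh_sum m 0 j = 1"
proof -
  have "lh_bounded 0 j = {\<lambda>_. undefined}"
    by (auto simp: lh_bounded_def lecture_hall_partitions_def)
  then show ?thesis
    by (simp add: lh_sum_def lh_term_def weight_def ceil_weight_def ceil_odd_def)
qed

lemma lh_sum_bound_0 [simp]: "lh_sum m n 0 = 1"
proof (induction n)
  case (Suc n)
  have "lh_bounded (Suc n) 0 = {l. l \<in> lecture_hall_partitions (Suc n) \<and> l (Suc n) = 0}"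
    by (auto simp: lh_bounded_def)
  moreover have "ceil_part l (Suc n) = 0" if "l (Suc n) = 0" for l
    using that by (simp add: ceil_part_def)
  ultimately show ?case
    using sum_last_part[of n 0 0 m] Suc.IH by (simp add: lh_sum_def wt_def)
qed simp

text \<open>
  If the last of \<open>n + 1\<close> parts is \<open>(n + 1) h + s + 1\<close>, the previous one is at most \<open>n h + s\<close>: the
  excess over \<open>h\<close> times the index drops by exactly one.
\<close>

lemma lh_sum_step:
  assumes "s \<le> n"
  shows "lh_sum m (Suc n) (Suc n * h + Suc s) = lh_sum m (Suc n) (Suc n * h + s)
           + x ^ (Suc n * h + Suc s + m * Suc h) * wt (Suc h) * lh_sum m n (n * h + s)"
proof -
  define j where "j = Suc n * h + s"
  have split: "lh_bounded (Suc n) (Suc j) =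
      lh_bounded (Suc n) j \<union> {l. l \<in> lecture_hall_partitions (Suc n) \<and> l (Suc n) = Suc j}"
    by (auto simp: lh_bounded_def)
  have "lh_sum m (Suc n) (Suc j) = lh_sum m (Suc n) j
      + (\<Sum>l | l \<in> lecture_hall_partitions (Suc n) \<and> l (Suc n) = Suc j. lh_term m (Suc n) l)"
    using finite_lh_bounded[of "Suc n" "Suc j"] unfolding lh_sum_def split
    by (subst sum.union_disjoint) (auto simp: lh_bounded_def)
  also have "(\<Sum>l | l \<in> lecture_hall_partitions (Suc n) \<and> l (Suc n) = Suc j. lh_term m (Suc n) l)
      = x ^ (Suc j + m * Suc h) * wt (Suc h) * lh_sum m n (Suc j * n div Suc n)"
    using assms by (intro sum_last_part ceil_part_eq_Suc[where s = s]) (auto simp: j_def)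
  also have "Suc j * n div Suc n = n * h + s"
  proof (rule div_nat_eqI)
    show "Suc n * (n * h + s) \<le> Suc j * n"
      using assms by (simp add: j_def algebra_simps)
    show "Suc j * n < Suc n * Suc (n * h + s)"
      using assms by (simp add: j_def algebra_simps)
  qed
  finally show ?thesis by (simp add: j_def)
qed

text \<open>Here \<open>c\<close> counts the parts of ceiling \<open>h + 1\<close>. They have the
  indices \<open>n - c + 1\<close> to \<open>n\<close>, and their excesses over \<open>h\<close>
  times the index increase strictly within 1 to \<open>s\<close>. Summing over such excesses gives
  \<open>qbinomial x s c * x ^ \<Sum>{..c}\<close>; the indices times \<open>h\<close> give the rest
  of the exponent, apart from the shift by \<open>m\<close>.\<close>

lemma lh_sum_expand:
  assumes "s \<le> n"
  shows "lh_sum m n (n * h + s) = (\<Sum>c\<le>s. qbinomial x s c * wt (Suc h) ^ c *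
           x ^ (h * (c * (n - c) + \<Sum>{..c}) + \<Sum>{..c} + m * Suc h * c) * lh_sum m (n - c) ((n - c) * h))"
  using assms
proof (induction s arbitrary: n)
  case 0
  then show ?case by simp
next
  case (Suc s)
  then obtain p where n: "n = Suc p" by (cases n) auto
  let ?e = "\<lambda>n c. h * (c * (n - c) + \<Sum>{..c}) + \<Sum>{..c} + m * Suc h * c"
  let ?g = "\<lambda>n c. wt (Suc h) ^ c * x ^ ?e n c * lh_sum m (n - c) ((n - c) * h)"
  have "(\<Sum>c\<le>Suc s. qbinomial x (Suc s) c * ?g n c) =
      (\<Sum>c\<le>s. x ^ (Suc p * h + Suc s + m * Suc h) * wt (Suc h) * (qbinomial x s c * ?g p c))
      + (\<Sum>c\<le>s. qbinomial x s c * ?g n c)"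
  proof (rule sum_atMost_Suc_pascal)
    fix c assume c: "c \<le> s"
    obtain d where p: "p = c + d"
      using c Suc.prems n le_Suc_ex[of c p] by auto
    obtain r where s: "s = c + r"
      using c le_Suc_ex by blast
    have "s - c + ?e n (Suc c) = Suc p * h + Suc s + m * Suc h + ?e p c"
      by (simp add: n p s algebra_simps)
    then have e: "x ^ (s - c) * x ^ ?e n (Suc c) = x ^ (Suc p * h + Suc s + m * Suc h) * x ^ ?e p c"
      by (simp only: power_add[symmetric])
    have "x ^ (s - c) * qbinomial x s c * ?g n (Suc c) = x ^ (s - c) * x ^ ?e n (Suc c) *
        (wt (Suc h) * qbinomial x s c * wt (Suc h) ^ c * lh_sum m (p - c) ((p - c) * h))"
      by (simp only: n diff_Suc_Suc power_Suc[of "wt (Suc h)"] ac_simps)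
    also have "\<dots> = x ^ (Suc p * h + Suc s + m * Suc h) * wt (Suc h) * (qbinomial x s c * ?g p c)"
      unfolding e by (simp only: ac_simps)
    finally show "qbinomial x (Suc s) (Suc c) * ?g n (Suc c) =
        x ^ (Suc p * h + Suc s + m * Suc h) * wt (Suc h) * (qbinomial x s c * ?g p c)
        + qbinomial x s (Suc c) * ?g n (Suc c)"
      unfolding qbinomial_pascal[OF c] distrib_right by (simp only:)
  qed (simp_all add: qbinomial_eq_0)
  also have "\<dots> = x ^ (Suc p * h + Suc s + m * Suc h) * wt (Suc h) * lh_sum m p (p * h + s)
      + lh_sum m n (n * h + s)"
    using Suc.IH[of p] Suc.IH[of n] Suc.prems n by (simp add: sum_distrib_left mult.assoc)
  also have "\<dots> = lh_sum m n (n * h + Suc s)"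
    using lh_sum_step[of s p m h] Suc.prems n by simp
  finally show ?case by (simp add: mult.assoc)
qed

section \<open>The product formula and removal of the lowest ceilings\<close>

definition num :: "nat \<Rightarrow> nat \<Rightarrow> 'a" where
  "num m n = (\<Prod>i=1..n. 1 + u * v * x ^ (m + i))"

text \<open>\<open>num\<close> and \<open>den\<close> are numerator and denominator of the product
  formula with \<open>u\<close> replaced by \<open>u * x ^ m\<close>.\<close>

definition den :: "nat \<Rightarrow> nat \<Rightarrow> 'a" where
  "den m n = (\<Prod>i=1..n. 1 - u\<^sup>2 * x ^ (2 * m + n + i))"

lemma lh_sum_expand_top:
  "lh_sum m n (n * Suc h) = (\<Sum>c\<le>n. qbinomial x n c * wt (Suc h) ^ c *
     x ^ (h * (c * (n - c) + \<Sum>{..c}) + \<Sum>{..c} + m * Suc h * c) * lh_sum m (n - c) ((n - c) * h))"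
  using lh_sum_expand[of n n m h] by (simp add: add.commute)

text \<open>With \<open>h = 0\<close> the remaining sums are 1, and the q-binomial theorem applies
  at \<open>y = u * v * x ^ m\<close>.\<close>

lemma lh_sum_height_1: "lh_sum m n n = num m n"
proof -
  have "lh_sum m n (n * Suc 0) = (\<Sum>c\<le>n. qbinomial x n c * (u * v * x ^ m) ^ c * x ^ (\<Sum>{..c}))"
    unfolding lh_sum_expand_top
    by (simp add: wt_def power_add power_mult_distrib ac_simps flip: power_mult)
  also have "\<dots> = num m n"
    unfolding qbinomial_theorem num_def by (simp add: power_add mult.assoc)
  finally show ?thesis by simp
qed

text \<open>Induction on \<open>h\<close>: remove the highest ceiling, expand the rest from the
  bottom, and exchange the order of the two removals by \<open>qbinomial_revision\<close>.\<close>

lemma lh_sum_expand_bottom: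
  "lh_sum m n (n * (h + 2)) = (\<Sum>k\<le>n. qbinomial x n k * (u\<^sup>2 * x ^ (2 * m + n + 1)) ^ k *
     num m (n - k) * lh_sum (m + (n - k)) k (k * h))"
proof (induction h arbitrary: m n)
  case 0
  have "lh_sum m n (n * (0 + 2)) = lh_sum m n (n * Suc 1)"
    by simp
  also have "\<dots> = (\<Sum>k\<le>n. qbinomial x n k * (u\<^sup>2 * x ^ (2 * m + n + 1)) ^ k *
     num m (n - k) * lh_sum (m + (n - k)) k (k * 0))"
    unfolding lh_sum_expand_top
  proof (rule sum.cong)
    fix c assume "c \<in> {..n}"
    then obtain d where n: "n = c + d"
      using le_Suc_ex by auto
    have "1 * (c * (n - c) + \<Sum>{..c}) + \<Sum>{..c} + m * Suc 1 * c = (2 * m + n + 1) * c"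
      using two_sum_atMost[of c] by (simp add: n algebra_simps)
    then show "qbinomial x n c * wt (Suc 1) ^ c *
        x ^ (1 * (c * (n - c) + \<Sum>{..c}) + \<Sum>{..c} + m * Suc 1 * c) * lh_sum m (n - c) ((n - c) * 1)
      = qbinomial x n c * (u\<^sup>2 * x ^ (2 * m + n + 1)) ^ c *
        num m (n - c) * lh_sum (m + (n - c)) c (c * 0)"
      by (simp only: power_mult_distrib power_mult[symmetric])
         (simp add: lh_sum_height_1 wt_def power_mult mult.assoc flip: numeral_2_eq_2)
  qed simp
  finally show ?case .
next
  case (Suc h)
  let ?e = "\<lambda>h m n c. h * (c * (n - c) + \<Sum>{..c}) + \<Sum>{..c} + m * Suc h * c"
  \<comment> \<open>In \<open>A\<close>, first \<open>c\<close> parts of ceiling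
    \<open>h + 3\<close> are removed, then \<open>k\<close> parts with ceilings from 2 to
    \<open>h + 2\<close>. In \<open>B\<close>, first all \<open>K = c + k\<close> parts of ceiling
    at least 2 are separated and lowered, then the \<open>c\<close> of them that now have ceiling
    \<open>h + 1\<close>.\<close>
  define A where "A c k = qbinomial x n c * wt (h + 3) ^ c * x ^ ?e (h + 2) m n c *
    (qbinomial x (n - c) k * (u\<^sup>2 * x ^ (2 * m + (n - c) + 1)) ^ k *
     num m (n - c - k) * lh_sum (m + (n - c - k)) k (k * h))" for c k
  define B where "B K c = qbinomial x n K * (u\<^sup>2 * x ^ (2 * m + n + 1)) ^ K * num m (n - K) *
    (qbinomial x K c * wt (Suc h) ^ c * x ^ ?e h (m + (n - K)) K c *
     lh_sum (m + (n - K)) (K - c) ((K - c) * h))" for K c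
  have AB: "A c (K - c) = B K c" if "c \<le> K" "K \<le> n" for c K
  proof -
    obtain k where K: "K = c + k" using \<open>c \<le> K\<close> le_Suc_ex by blast
    obtain p where n: "n = c + k + p" using \<open>K \<le> n\<close> K le_Suc_ex by blast
    have w: "wt (h + 3) = u\<^sup>2 * wt (Suc h)"
    proof -
      have "(h + 3) mod 2 = Suc h mod 2" by presburger
      then show ?thesis by (simp add: wt_def power2_eq_square eval_nat_numeral)
    qed
    have "?e (h + 2) m (c + k + p) c + (2 * m + (k + p) + 1) * k
        = (2 * m + (c + k + p) + 1) * (c + k) + ?e h (m + p) (c + k) c"
      using two_sum_atMost[of c] by (simp add: algebra_simps)
    then have e: "x ^ ?e (h + 2) m (c + k + p) c * x ^ ((2 * m + (k + p) + 1) * k)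
        = x ^ ((2 * m + (c + k + p) + 1) * (c + k)) * x ^ ?e h (m + p) (c + k) c"
      by (simp only: power_add[symmetric])
    define r where "r = u ^ (2 * (c + k)) * wt (Suc h) ^ c * num m p * lh_sum (m + p) k (k * h)"
    have r': "u ^ (2 * (c + k)) = u ^ (2 * c) * u ^ (2 * k)"
      by (simp add: power_add distrib_left)
    have d: "c + k + p - c = k + p" "c + k + p - c - k = p" "c + k + p - (c + k) = p"
       "c + k - c = k" "k + p - k = p" by auto
    have "A c (K - c) = (qbinomial x (c + k + p) c * qbinomial x (k + p) k) *
        (x ^ ?e (h + 2) m (c + k + p) c * x ^ ((2 * m + (k + p) + 1) * k)) * r"
      unfolding A_def K n d w power_mult_distrib r_def power_mult[symmetric] r'
      by (simp only: ac_simps)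
    also have "\<dots> = B K c"
      unfolding e qbinomial_revision[OF power_neq_1]
      unfolding B_def K n d power_mult_distrib r_def power_mult[symmetric]
      by (simp only: ac_simps)
    finally show ?thesis .
  qed
  have "lh_sum m n (n * (Suc h + 2)) = (\<Sum>c\<le>n. \<Sum>k\<le>n - c. A c k)"
  proof -
    have "lh_sum m n (n * (Suc h + 2)) = lh_sum m n (n * Suc (h + 2))"
      by simp
    also have "\<dots> = (\<Sum>c\<le>n. \<Sum>k\<le>n - c. A c k)"
      unfolding lh_sum_expand_top Suc.IH sum_distrib_left A_def by (simp add: eval_nat_numeral)
    finally show ?thesis .
  qed
  also have "\<dots> = (\<Sum>K\<le>n. \<Sum>c\<le>K. A c (K - c))"
    by (rule sum_triangle)
  also have "\<dots> = (\<Sum>K\<le>n. \<Sum>c\<le>K. B K c)"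
    using AB by simp
  also have "\<dots> = (\<Sum>k\<le>n. qbinomial x n k * (u\<^sup>2 * x ^ (2 * m + n + 1)) ^ k *
     num m (n - k) * lh_sum (m + (n - k)) k (k * Suc h))"
    \<comment> \<open>The inner sum over \<open>c\<close> is the top expansion at height
      \<open>h + 1\<close>, read backwards.\<close>
    unfolding lh_sum_expand_top sum_distrib_left B_def ..
  finally show ?case .
qed

lemma num_split: "k \<le> n \<Longrightarrow> num m n = num m (n - k) * num (m + (n - k)) k"
proof -
  assume "k \<le> n"
  then have "num m n = num m (n - k) * (\<Prod>i=n-k+1..n-k+k. 1 + u * v * x ^ (m + i))"
    unfolding num_def by (subst prod.ub_add_nat[symmetric]) auto
  also have "(\<Prod>i=n-k+1..n-k+k. 1 + u * v * x ^ (m + i)) = num (m + (n - k)) k"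
    unfolding num_def
    by (rule prod.reindex_bij_witness[where i = "\<lambda>i. i + (n - k)" and j = "\<lambda>i. i - (n - k)"]) auto
  finally show ?thesis .
qed

text \<open>Since \<open>2 * (m + (n - k)) + k = 2 * m + n + (n - k)\<close>, the last
  \<open>k\<close> factors form a denominator again. The others are the product in
  \<open>qbinomial_partition_unity\<close>.\<close>

lemma den_split:
  assumes "k \<le> n"
  shows "den m n = (\<Prod>j<n - k. 1 - (u\<^sup>2 * x ^ (2 * m + n + 1)) * x ^ j) * den (m + (n - k)) k"
proof -
  have "den m n = (\<Prod>i=1..n-k. 1 - u\<^sup>2 * x ^ (2 * m + n + i)) *
      (\<Prod>i=n-k+1..n-k+k. 1 - u\<^sup>2 * x ^ (2 * m + n + i))"
    unfolding den_def using assms by (subst prod.ub_add_nat[symmetric]) auto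
  also have "(\<Prod>i=1..n-k. 1 - u\<^sup>2 * x ^ (2 * m + n + i)) =
      (\<Prod>j<n - k. 1 - (u\<^sup>2 * x ^ (2 * m + n + 1)) * x ^ j)"
    by (rule prod.reindex_bij_witness[where i = Suc and j = "\<lambda>i. i - 1"])
       (auto simp: mult.assoc simp flip: power_add power_Suc)
  also have "(\<Prod>i=n-k+1..n-k+k. 1 - u\<^sup>2 * x ^ (2 * m + n + i)) = den (m + (n - k)) k"
    unfolding den_def
    by (rule prod.reindex_bij_witness[where i = "\<lambda>i. i + (n - k)" and j = "\<lambda>i. i - (n - k)"])
       (use assms in \<open>auto simp: algebra_simps\<close>)
  finally show ?thesis .
qed

text \<open>Each use of the bottom expansion gains one factor \<open>x\<close>, from
  \<open>z ^ k\<close> with \<open>k > 0\<close>; the term \<open>k = 0\<close> has no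
  error.\<close>

lemma lh_sum_approx: "x ^ h dvd den m n * lh_sum m n (n * (2 * h)) - num m n"
proof (induction h arbitrary: m n)
  case 0
  then show ?case by simp
next
  case (Suc h)
  define z where "z = u\<^sup>2 * x ^ (2 * m + n + 1)"
  let ?Q = "\<lambda>k. \<Prod>j<n - k. 1 - z * x ^ j"
  let ?M = "\<lambda>k. m + (n - k)"
  have "den m n * lh_sum m n (n * (2 * Suc h)) = den m n * lh_sum m n (n * (2 * h + 2))"
    by simp
  also have "\<dots> = (\<Sum>k\<le>n. qbinomial x n k * z ^ k * ?Q k *
      (num m (n - k) * (den (?M k) k * lh_sum (?M k) k (k * (2 * h)))))"
    unfolding lh_sum_expand_bottom sum_distrib_left
    by (intro sum.cong refl) (simp add: den_split[of _ n m] z_def ac_simps)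
  finally have 1: "den m n * lh_sum m n (n * (2 * Suc h)) = \<dots>" .
  \<comment> \<open>Inserting the partition of unity gives \<open>num\<close> the same
    recursion.\<close>
  have "num m n = (\<Sum>k\<le>n. qbinomial x n k * z ^ k * ?Q k) * num m n"
    by (simp add: qbinomial_partition_unity)
  also have "\<dots> = (\<Sum>k\<le>n. qbinomial x n k * z ^ k * ?Q k * (num m (n - k) * num (?M k) k))"
    unfolding sum_distrib_right by (intro sum.cong refl) (simp add: num_split[of _ n m])
  finally have 2: "num m n = \<dots>" .
  have "den m n * lh_sum m n (n * (2 * Suc h)) - num m n =
     (\<Sum>k\<le>n. qbinomial x n k * z ^ k * ?Q k * (num m (n - k) *
        (den (?M k) k * lh_sum (?M k) k (k * (2 * h)) - num (?M k) k)))"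
    unfolding 1 by (subst 2) (simp add: sum_subtractf[symmetric] right_diff_distrib)
  also have "x ^ Suc h dvd \<dots>"
  proof (rule dvd_sum)
    fix k
    show "x ^ Suc h dvd qbinomial x n k * z ^ k * ?Q k * (num m (n - k) *
        (den (?M k) k * lh_sum (?M k) k (k * (2 * h)) - num (?M k) k))"
    proof (cases k)
      case 0
      then show ?thesis by (simp add: den_def num_def)
    next
      case (Suc k')
      have "x dvd z ^ k"
        using Suc by (simp add: z_def)
      then have "x * x ^ h dvd z ^ k * (den (?M k) k * lh_sum (?M k) k (k * (2 * h)) - num (?M k) k)"
        by (intro mult_dvd_mono Suc.IH)
      then have "x ^ Suc h dvd (qbinomial x n k * ?Q k * num m (n - k)) *
          (z ^ k * (den (?M k) k * lh_sum (?M k) k (k * (2 * h)) - num (?M k) k))"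
        by (simp add: dvd_mult)
      then show ?thesis by (simp only: ac_simps)
    qed
  qed
  finally show ?case .
qed

end

section \<open>Passage to the infinite sum of power series\<close>

lemma fps_X_power_dvd_imp_nth:
  fixes f :: "'a::comm_ring_1 fps"
  shows "fps_X ^ k dvd f \<Longrightarrow> i < k \<Longrightarrow> fps_nth f i = 0"
  by (auto simp: fps_X_power_mult_nth elim!: dvdE)

lemma dvd_diff_fps_frac:
  assumes "fps_nth g 0 = 1" and "d dvd g * s - f"
  shows "d dvd s - fps_frac f g"
proof -
  have inv: "g * fps_right_inverse g 1 = 1"
    by (rule fps_right_inverse) (simp add: assms)
  have "fps_right_inverse g 1 * (g * s - f) = g * fps_right_inverse g 1 * s - f * fps_right_inverse g 1"
    by (simp add: algebra_simps)
  then have "s - fps_frac f g = fps_right_inverse g 1 * (g * s - f)"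
    by (simp add: inv fps_frac_def)
  then show ?thesis using assms by simp
qed

theorem theorem5p1:
  fixes n :: nat
  assumes "n > 0"
  shows "((\<lambda>l. fps_X ^ weight n l * var_u ^ ceil_weight n l * var_v ^ ceil_odd n l)
            has_sum
          fps_frac (\<Prod>i = 1..n. 1 + var_u * var_v * fps_X ^ i)
                   (\<Prod>i = 1..n. 1 - var_u ^ 2 * fps_X ^ (n + i)))
         (lecture_hall_partitions n)"
proof -
  interpret lecture_hall_weights fps_X var_u var_v
  proof
    show "fps_X ^ Suc i \<noteq> (1 :: int poly poly fps)" for i
      by (metis fps_X_power_nth fps_one_nth zero_neq_one nat.distinct(1))
  qed
  let ?f = "\<lambda>l. fps_X ^ weight n l * var_u ^ ceil_weight n l * var_v ^ ceil_odd n l"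
  have "((\<lambda>Y. \<Sum>l\<in>Y. ?f l) \<longlongrightarrow> fps_frac (num 0 n) (den 0 n))
      (finite_subsets_at_top (lecture_hall_partitions n))"
  \<comment> \<open>It suffices that each coefficient eventually equals that of the limit.\<close>
  proof (rule tendsto_fpsI)
    fix N
    \<comment> \<open>Ceilings up to \<open>2 * Suc N\<close> give agreement modulo
      \<open>fps_X ^ Suc N\<close>, which includes the coefficient of index
      \<open>N\<close>.\<close>
    define X where "X = lh_bounded n (n * (2 * Suc N))"
    have den0: "fps_nth (den 0 n) 0 = 1"
    proof -
      have "fps_nth (\<Prod>i=1..k. 1 - var_u\<^sup>2 * fps_X ^ (n + i)) 0 = 1" for k
        by (induction k) (simp_all add: fps_X_power_mult_right_nth)
      then show ?thesis by (simp add: den_def)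
    qed
    have "fps_X ^ Suc N dvd (\<Sum>l\<in>X. ?f l) - fps_frac (num 0 n) (den 0 n)"
      using dvd_diff_fps_frac[OF den0 lh_sum_approx[of "Suc N" 0 n]]
      by (simp add: lh_sum_def lh_term_def X_def)
    then have X: "fps_nth (\<Sum>l\<in>X. ?f l) N = fps_nth (fps_frac (num 0 n) (den 0 n)) N"
      using fps_X_power_dvd_imp_nth[of "Suc N" _ N] by fastforce
    have "fps_nth (\<Sum>l\<in>Y. ?f l) N = fps_nth (fps_frac (num 0 n) (den 0 n)) N"
      if Y: "finite Y" "X \<subseteq> Y" "Y \<subseteq> lecture_hall_partitions n" for Y
    proof -
      \<comment> \<open>Outside \<open>X\<close> the last part alone exceeds \<open>N\<close>, so
        the term has no coefficient at \<open>N\<close>.\<close>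
      have "fps_nth (?f l) N = 0" if "l \<in> Y - X" for l
      proof -
        have "N < n * (2 * Suc N)"
          using assms by (cases n) auto
        also have "\<dots> < l n"
          using that Y assms by (auto simp: X_def lh_bounded_def)
        also have "l n \<le> weight n l"
          unfolding weight_def using assms by (intro member_le_sum) auto
        finally show ?thesis
          by (simp add: mult.assoc fps_X_power_mult_nth)
      qed
      then have "fps_nth (\<Sum>l\<in>Y - X. ?f l) N = 0"
        by (simp add: fps_sum_nth)
      then show ?thesis
        using sum.subset_diff[OF Y(2,1), of ?f] X by simp
    qed
    moreover have "finite X" "X \<subseteq> lecture_hall_partitions n"
      by (auto simp: X_def finite_lh_bounded) (auto simp: lh_bounded_def)
    ultimately show "\<forall>\<^sub>F Y in finite_subsets_at_top (lecture_hall_partitions n).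
        fps_nth (\<Sum>l\<in>Y. ?f l) N = fps_nth (fps_frac (num 0 n) (den 0 n)) N"
      unfolding eventually_finite_subsets_at_top by blast
  qed
  then show ?thesis
    by (simp add: has_sum_def num_def den_def)
qed

end
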